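(* For every $R>0$ and every point $M$ at distance $L\ge 0$ from the centroid of the solid, the cyclic averages of the Platonic solids with circumradius $R$ are the following: $$S_{[4]}^{(2)}=S_{[6]}^{(2)}=S_{[8]}^{(2)}=S_{[12]}^{(2)}=S_{[20]}^{(2)}=R^2+L^2,$$ $$S_{[4]}^{(4)}=S_{[6]}^{(4)}=S_{[8]}^{(4)}=S_{[12]}^{(4)}=S_{[20]}^{(4)}=(R^2+L^2)^2+\frac43R^2L^2,$$ $$S_{[6]}^{(6)}=S_{[8]}^{(6)}=S_{[12]}^{(6)}=S_{[20]}^{(6)}=(R^2+L^2)^3+4R^2L^2(R^2+L^2),$$ $$S_{[12]}^{(8)}=S_{[20]}^{(8)}=(R^2+L^2)^4+8R^2L^2(R^2+L^2)^2+\frac{16}{5}R^4L^4,$$ $$S_{[12]}^{(10)}=S_{[20]}^{(10)}=(R^2+L^2)^5+\frac{40}{3}R^2L^2(R^2+L^2)^3+16R^4L^4(R^2+L^2).$$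
   Context: The Platonic solid with $n$ vertices is the regular tetrahedron ($n=4$), regular octahedron ($n=6$), cube ($n=8$), regular icosahedron ($n=12$) or regular dodecahedron ($n=20$). For such a solid in Euclidean $3$-space with vertices $A_1,\dots,A_n$, circumradius $R$ and centroid $O$, and a point $M$ of the space with $|MO|=L$, put $d_i=|MA_i|$ and $S_{[n]}^{(2m)}=\frac1n\sum_{i=1}^n d_i^{2m}$. *)

theory Defs
  imports "HOL-Analysis.Analysis"
begin

definition vertices :: "(real^3) set \<Rightarrow> (real^3) set" where
  "vertices P = {v. v extreme_point_of P}"

definition centroid :: "(real^3) set \<Rightarrow> real^3" where
  "centroid P = (1 / real (card (vertices P))) *\<^sub>R (\<Sum>A\<in>vertices P. A)"

definition has_circumradius :: "(real^3) set \<Rightarrow> real \<Rightarrow> bool" where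
  "has_circumradius P R \<longleftrightarrow> (\<exists>c. vertices P \<subseteq> sphere c R)"

text \<open>
  The exponent \<^term>\<open>k\<close> is the power of the distance itself, so the average written
  \<open>S\<close> with lower index \<open>[n]\<close> and upper index \<open>(2m)\<close> is \<open>cyclic_average P M (2 * m)\<close>,
  where \<open>n\<close> is the number of vertices of \<open>P\<close>.
\<close>

definition cyclic_average :: "(real^3) set \<Rightarrow> real^3 \<Rightarrow> nat \<Rightarrow> real" where
  "cyclic_average P M k =
     (1 / real (card (vertices P))) * (\<Sum>A\<in>vertices P. dist M A ^ k)"

definition similar :: "(real^3) set \<Rightarrow> (real^3) set \<Rightarrow> bool" where
  "similar P Q \<longleftrightarrow>
     (\<exists>f s. s > 0 \<and> (\<forall>x y. dist (f x) (f y) = s * dist x y) \<and> P = f ` Q)"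

definition golden_ratio :: real where
  "golden_ratio = (1 + sqrt 5) / 2"

text \<open>
  Each regular solid is determined up to similarity (reflections included), and is defined
  as any solid similar to the usual model centred at the origin. The edges of the models
  have length \<open>2 * sqrt 2\<close> (tetrahedron), \<open>sqrt 2\<close> (octahedron), \<open>2\<close> (cube and icosahedron)
  and \<open>2 / golden_ratio\<close> (dodecahedron).
\<close>

definition std_tetrahedron :: "(real^3) set" where
  "std_tetrahedron = convex hull
     {vector [1, 1, 1], vector [1, -1, -1], vector [-1, 1, -1], vector [-1, -1, 1]}"

definition std_octahedron :: "(real^3) set" where
  "std_octahedron = convex hull
     {vector [1, 0, 0], vector [-1, 0, 0], vector [0, 1, 0],
      vector [0, -1, 0], vector [0, 0, 1], vector [0, 0, -1]}"

definition std_cube :: "(real^3) set" where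
  "std_cube = convex hull
     {vector [a, b, c] | a b c. a \<in> {1, -1} \<and> b \<in> {1, -1} \<and> c \<in> {1, -1}}"

definition std_icosahedron :: "(real^3) set" where
  "std_icosahedron = convex hull
     ({vector [0, a, b * golden_ratio] | a b. a \<in> {1, -1} \<and> b \<in> {1, -1}} \<union>
      {vector [a, b * golden_ratio, 0] | a b. a \<in> {1, -1} \<and> b \<in> {1, -1}} \<union>
      {vector [b * golden_ratio, 0, a] | a b. a \<in> {1, -1} \<and> b \<in> {1, -1}})"

definition std_dodecahedron :: "(real^3) set" where
  "std_dodecahedron = convex hull
     ({vector [a, b, c] | a b c. a \<in> {1, -1} \<and> b \<in> {1, -1} \<and> c \<in> {1, -1}} \<union>
      {vector [0, a * golden_ratio, b / golden_ratio] | a b. a \<in> {1, -1} \<and> b \<in> {1, -1}} \<union>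
      {vector [a * golden_ratio, b / golden_ratio, 0] | a b. a \<in> {1, -1} \<and> b \<in> {1, -1}} \<union>
      {vector [b / golden_ratio, 0, a * golden_ratio] | a b. a \<in> {1, -1} \<and> b \<in> {1, -1}})"

definition regular_tetrahedron :: "(real^3) set \<Rightarrow> bool" where
  "regular_tetrahedron P \<longleftrightarrow> similar P std_tetrahedron"

definition regular_octahedron :: "(real^3) set \<Rightarrow> bool" where
  "regular_octahedron P \<longleftrightarrow> similar P std_octahedron"

definition cube :: "(real^3) set \<Rightarrow> bool" where
  "cube P \<longleftrightarrow> similar P std_cube"

definition regular_icosahedron :: "(real^3) set \<Rightarrow> bool" where
  "regular_icosahedron P \<longleftrightarrow> similar P std_icosahedron"

definition regular_dodecahedron :: "(real^3) set \<Rightarrow> bool" where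
  "regular_dodecahedron P \<longleftrightarrow> similar P std_dodecahedron"

definition platonic_solid :: "nat \<Rightarrow> (real^3) set \<Rightarrow> bool" where
  "platonic_solid n P \<longleftrightarrow>
     n = 4 \<and> regular_tetrahedron P \<or>
     n = 6 \<and> regular_octahedron P \<or>
     n = 8 \<and> cube P \<or>
     n = 12 \<and> regular_icosahedron P \<or>
     n = 20 \<and> regular_dodecahedron P"

end

theory Submission
  imports Defs
begin

text \<open>
  If the solid is centred at the origin, then the square of the distance from \<open>x\<close> to a vertex \<open>v\<close>
  is \<open>R^2 + L^2 - 2 v \<bullet> x\<close>. The \<open>m\<close>-th power of this is expanded by the binomial theorem, so the
  average of order \<open>2 * m\<close> depends only on the moments of \<open>v \<bullet> x\<close> of order at most \<open>m\<close>. The vertices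
  form a spherical design, that is, their low moments agree with those of the uniform distribution
  on the sphere; the strength is 2 for the tetrahedron, 3 for the octahedron and the cube, and 5 for
  the icosahedron and the dodecahedron.
\<close>

section \<open>Spherical designs and powers of the distance\<close>

text \<open>
  A design is usually required to integrate all polynomials of degree at most \<open>t\<close>; powers of linear
  forms span these. The factor \<open>1 / (k + 1)\<close> is the \<open>k\<close>-th moment, for even \<open>k\<close>, of a coordinate on
  the unit sphere, which is uniformly distributed on \<open>[-1, 1]\<close> in dimension 3.
\<close>

definition spherical_design :: "nat \<Rightarrow> real \<Rightarrow> (real^3) set \<Rightarrow> bool" where
  "spherical_design t r V \<longleftrightarrow> finite V \<and> V \<noteq> {} \<and> r > 0 \<and> (\<forall>v\<in>V. norm v = r) \<and>
     (\<forall>k\<le>t. \<forall>x. (\<Sum>v\<in>V. (v \<bullet> x) ^ k) =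
        (if odd k then 0 else card V * (r * norm x) ^ k / (real k + 1)))"

lemma spherical_design_moment:
  "spherical_design t r V \<Longrightarrow> k \<le> t \<Longrightarrow>
     (\<Sum>v\<in>V. (v \<bullet> x) ^ k) = (if odd k then 0 else card V * (r * norm x) ^ k / (real k + 1))"
  unfolding spherical_design_def by blast

text \<open>The first moment in the direction of \<open>\<Sum>V\<close> is the squared norm of
  \<open>\<Sum>V\<close>.\<close>

lemma spherical_design_sum_0:
  assumes "spherical_design t r V" "1 \<le> t"
  shows "\<Sum>V = 0"
proof -
  have "\<Sum>V \<bullet> \<Sum>V = (\<Sum>v\<in>V. v \<bullet> \<Sum>V)"
    by (rule inner_sum_left)
  also have "\<dots> = 0"
    using spherical_design_moment[OF assms, of "\<Sum>V"] by simp
  finally show ?thesis by simp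
qed

lemma spherical_design_distance_power:
  assumes V: "spherical_design t r V" and m: "m \<le> t"
  shows "(1 / card V) * (\<Sum>v\<in>V. dist x v ^ (2 * m)) =
    (\<Sum>k\<le>m. of_nat (m choose k) * (if odd k then 0 else (2 * r * norm x) ^ k / (real k + 1))
       * (r\<^sup>2 + (norm x)\<^sup>2) ^ (m - k))"
proof -
  have card: "real (card V) > 0"
    using V by (simp add: spherical_design_def card_gt_0_iff)
  have d: "dist x v ^ (2 * m) = (\<Sum>k\<le>m. of_nat (m choose k) * (-2 * (v \<bullet> x)) ^ k
       * (r\<^sup>2 + (norm x)\<^sup>2) ^ (m - k))" if "v \<in> V" for v
  proof -
    have "norm v = r"
      using V that by (simp add: spherical_design_def)
    hence "(dist x v)\<^sup>2 = -2 * (v \<bullet> x) + (r\<^sup>2 + (norm x)\<^sup>2)"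
      by (simp add: dist_norm power2_norm_eq_inner inner_diff inner_commute flip: \<open>norm v = r\<close>)
    thus ?thesis
      by (simp only: power_mult binomial_ring)
  qed
  have "(\<Sum>v\<in>V. dist x v ^ (2 * m)) = (\<Sum>v\<in>V. \<Sum>k\<le>m. of_nat (m choose k) *
      (-2 * (v \<bullet> x)) ^ k * (r\<^sup>2 + (norm x)\<^sup>2) ^ (m - k))"
    using d by (intro sum.cong) auto
  also have "\<dots> = (\<Sum>k\<le>m. of_nat (m choose k) * ((-2) ^ k * (\<Sum>v\<in>V. (v \<bullet> x) ^ k))
      * (r\<^sup>2 + (norm x)\<^sup>2) ^ (m - k))"
    by (subst sum.swap) (simp only: power_mult_distrib sum_distrib_left sum_distrib_right mult.assoc)
  \<comment> \<open>Only even \<open>k\<close> survive, so the sign of \<open>(-2) ^ k\<close>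
    disappears and the 2 joins \<open>r * norm x\<close>.\<close>
  also have "\<dots> = (\<Sum>k\<le>m. card V * (of_nat (m choose k) *
      (if odd k then 0 else (2 * r * norm x) ^ k / (real k + 1)) * (r\<^sup>2 + (norm x)\<^sup>2) ^ (m - k)))"
    using m by (intro sum.cong refl)
      (auto simp: spherical_design_moment[OF V] power_mult_distrib mult_ac)
  also have "\<dots> = card V * (\<Sum>k\<le>m. of_nat (m choose k) *
      (if odd k then 0 else (2 * r * norm x) ^ k / (real k + 1)) * (r\<^sup>2 + (norm x)\<^sup>2) ^ (m - k))"
    by (rule sum_distrib_left[symmetric])
  finally show ?thesis
    using card by simp
qed

section \<open>Extreme points of hulls and of affine images\<close>

text \<open>The hull lies in the ball of radius \<open>r\<close>, but a point inside a segment is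
  strictly closer to 0 than one of the ends.\<close>

lemma extreme_points_of_convex_hull_sphere:
  fixes V :: "'a::euclidean_space set"
  assumes "\<And>v. v \<in> V \<Longrightarrow> norm v = r"
  shows "{v. v extreme_point_of (convex hull V)} = V"
proof (intro equalityI extreme_points_of_convex_hull subsetI CollectI)
  fix v assume v: "v \<in> V"
  have le: "dist 0 u \<le> r" if "u \<in> convex hull V" for u
    using that hull_minimal[of V "cball 0 r" convex] assms by (auto simp: subset_iff)
  show "v extreme_point_of (convex hull V)"
    unfolding extreme_point_of_def
  proof (intro conjI ballI notI)
    fix a b assume ab: "a \<in> convex hull V" "b \<in> convex hull V" "v \<in> open_segment a b"
    hence "dist 0 v < dist 0 a \<or> dist 0 v < dist 0 b"
      using dist_decreases_open_segment by blast
    with le[OF ab(1)] le[OF ab(2)] assms[OF v] show False by auto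
  qed (use v hull_inc in fast)
qed

text \<open>Extreme points are singleton faces, and injective linear maps preserve faces; the
  translation is split off.\<close>

lemma extreme_points_of_affine_image:
  fixes h :: "'a::euclidean_space \<Rightarrow> 'b::euclidean_space"
  assumes "linear h" "inj h"
  shows "{v. v extreme_point_of ((\<lambda>x. c + h x) ` S)} = (\<lambda>x. c + h x) ` {v. v extreme_point_of S}"
proof -
  have "{v. v extreme_point_of (h ` S)} = h ` {v. v extreme_point_of S}"
  proof -
    have "h v extreme_point_of (h ` S) \<longleftrightarrow> v extreme_point_of S" for v
      using face_of_linear_image[OF assms, of "{v}" S] by (simp add: face_of_singleton)
    moreover have "u \<in> h ` S" if "u extreme_point_of (h ` S)" for u
      using that by (simp add: extreme_point_of_def)
    ultimately show ?thesis by blast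
  qed
  moreover have "(\<lambda>x. c + h x) ` T = (+) c ` h ` T" for T
    by (simp add: image_image)
  ultimately show ?thesis
    by (simp add: extreme_points_of_translation)
qed

section \<open>Transfer from the centred model to similar solids\<close>

text \<open>The similarity carries the origin to the centroid and multiplies the radius and all
  distances by \<open>s\<close>, so both sides of the centred formula scale by
  \<open>s ^ (2 * m)\<close>.\<close>

lemma cyclic_average_similar_design:
  assumes P: "similar P (convex hull V)" and V: "spherical_design t r V" and t: "2 \<le> t"
    and R: "has_circumradius P R" "R > 0" and L: "dist M (centroid P) = L" and m: "m \<le> t"
  shows "cyclic_average P M (2 * m) =
    (\<Sum>k\<le>m. of_nat (m choose k) * (if odd k then 0 else (2 * R * L) ^ k / (real k + 1))
       * (R\<^sup>2 + L\<^sup>2) ^ (m - k))"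
proof -
  obtain f s where s: "s > 0" and f: "\<And>x y. dist (f x) (f y) = s * dist x y"
    and Pf: "P = f ` (convex hull V)"
    using P unfolding similar_def by blast
  define h where "h x = f x - f 0" for x
  \<comment> \<open>A map that fixes 0 and scales all distances by the same factor is
    linear.\<close>
  have h: "linear h"
    by (rule scaling_linear[where c = s]) (use f in \<open>simp_all add: h_def dist_norm\<close>)
  have "inj h"
    using s f by (intro injI) (metis h_def diff_add_cancel dist_eq_0_iff mult_eq_0_iff less_numeral_extra(3))
  have fh: "f = (\<lambda>x. f 0 + h x)" by (simp add: h_def)
  \<comment> \<open>Surjectivity supplies preimages of the circumcentre and of
    \<open>M\<close>.\<close>
  have "surj h"
    by (rule linear_inj_imp_surj) fact+
  hence surj: "\<exists>x. f x = y" for y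
    by (metis fh surjD add_diff_cancel_left' diff_add_cancel add.commute)
  have inj: "inj f"
    by (subst fh) (use \<open>inj h\<close> in \<open>auto simp: inj_def\<close>)
  have norms: "norm v = r" if "v \<in> V" for v
    using V that by (simp add: spherical_design_def)
  have vert: "vertices P = f ` V"
    using extreme_points_of_affine_image[OF h \<open>inj h\<close>, of "f 0" "convex hull V"]
    unfolding vertices_def Pf fh[symmetric]
    by (simp add: extreme_points_of_convex_hull_sphere[of V r] norms)
  have card: "card (vertices P) = card V"
    unfolding vert using inj by (intro card_image) (auto intro: inj_on_subset)
  have avg: "(\<Sum>A\<in>vertices P. g A) = (\<Sum>v\<in>V. g (f v))" for g :: "_ \<Rightarrow> 'b::comm_monoid_add"
    unfolding vert using inj by (subst sum.reindex) (auto intro: inj_on_subset)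
  have cV: "real (card V) > 0"
    using V by (simp add: spherical_design_def card_gt_0_iff)
  have "(\<Sum>v\<in>V. f v) = real (card V) *\<^sub>R f 0 + h (\<Sum>V)"
    by (subst fh) (simp add: sum.distrib linear_sum[OF h] sum_constant_scaleR del: sum_constant)
  hence centroid: "centroid P = f 0"
    using spherical_design_sum_0[OF V] t cV linear_0[OF h] 
    by (simp add: centroid_def card avg)
  \<comment> \<open>The circumradius comes with some centre \<open>c\<close>, not known to be the
    centroid; its preimage \<open>y\<close> has to be shown to be 0.\<close>
  obtain c where c: "\<And>A. A \<in> vertices P \<Longrightarrow> dist c A = R"
    using R(1) unfolding has_circumradius_def by (auto simp: subset_iff)
  obtain y where y: "f y = c" using surj by blast
  have yv: "(s * norm (y - v))\<^sup>2 = R\<^sup>2" if "v \<in> V" for v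
    using c[of "f v"] that f by (simp add: vert flip: y dist_norm)
  txt \<open>
    A second point equidistant from the vertices would make \<open>v \<bullet> y\<close> constant, hence zero by the
    first moment, which contradicts the second moment.
  \<close>
  define \<alpha> where "\<alpha> = (r\<^sup>2 + (norm y)\<^sup>2 - (R / s)\<^sup>2) / 2"
  have inner: "v \<bullet> y = \<alpha>" if "v \<in> V" for v
  proof -
    have "(norm (y - v))\<^sup>2 = (R / s)\<^sup>2"
      using yv[OF that] s by (simp add: field_simps)
    thus ?thesis
      using norms[OF that] 
      by (simp add: \<alpha>_def power2_norm_eq_inner inner_diff inner_commute flip: norms[OF that])
  qed
  have "\<alpha> = 0"
    using spherical_design_moment[OF V, of 1 y] t inner cV by simp
  hence "real (card V) * (r * norm y)\<^sup>2 = 0"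
    using spherical_design_moment[OF V, of 2 y] t inner by simp
  hence "y = 0"
    using cV V by (simp add: spherical_design_def)
  obtain v where "v \<in> V" using V by (auto simp: spherical_design_def)
  have Rsr: "R = s * r"
    using c[of "f v"] f[of 0 v] norms \<open>v \<in> V\<close> by (simp add: vert \<open>y = 0\<close> flip: y)
  obtain x where x: "f x = M" using surj by blast
  have Lx: "L = s * norm x"
    using L by (simp add: centroid f flip: x)
  have "cyclic_average P M (2 * m) = s ^ (2 * m) * ((1 / card V) * (\<Sum>v\<in>V. dist x v ^ (2 * m)))"
    by (simp add: cyclic_average_def card avg f power_mult_distrib sum_distrib_left flip: x)
  also have "\<dots> = (\<Sum>k\<le>m. s ^ (2 * m) * (of_nat (m choose k) *
      (if odd k then 0 else (2 * r * norm x) ^ k / (real k + 1)) * (r\<^sup>2 + (norm x)\<^sup>2) ^ (m - k)))"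
    by (subst spherical_design_distance_power[OF V m]) (rule sum_distrib_left)
  also have "\<dots> = (\<Sum>k\<le>m. of_nat (m choose k) * (if odd k then 0 else (2 * R * L) ^ k / (real k + 1))
       * (R\<^sup>2 + L\<^sup>2) ^ (m - k))"
  proof (intro sum.cong refl)
    \<comment> \<open>Each term is homogeneous of total degree \<open>m\<close> in
      \<open>2 * R * L\<close> and \<open>R\<^sup>2 + L\<^sup>2\<close>, both of which scale by
      \<open>s\<^sup>2\<close>.\<close>
    fix k assume "k \<in> {..m}"
    hence "s ^ (2 * m) = (s\<^sup>2) ^ k * (s\<^sup>2) ^ (m - k)"
      by (simp add: power_mult flip: power_add)
    moreover have "2 * R * L = s\<^sup>2 * (2 * r * norm x)" "R\<^sup>2 + L\<^sup>2 = s\<^sup>2 * (r\<^sup>2 + (norm x)\<^sup>2)"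
      by (simp_all add: Rsr Lx power2_eq_square algebra_simps)
    ultimately show "s ^ (2 * m) * (of_nat (m choose k) *
      (if odd k then 0 else (2 * r * norm x) ^ k / (real k + 1)) * (r\<^sup>2 + (norm x)\<^sup>2) ^ (m - k)) =
      of_nat (m choose k) * (if odd k then 0 else (2 * R * L) ^ k / (real k + 1))
       * (R\<^sup>2 + L\<^sup>2) ^ (m - k)"
      by (simp only: power_mult_distrib) simp
  qed
  finally show ?thesis .
qed

section \<open>The golden ratio and coordinates\<close>

lemma golden_ratio_pos: "golden_ratio > 0"
  by (simp add: golden_ratio_def add_pos_nonneg)

lemma golden_ratio_square: "golden_ratio\<^sup>2 = golden_ratio + 1"
  by (simp add: golden_ratio_def power2_eq_square field_simps)

lemma inverse_golden_ratio: "1 / golden_ratio = golden_ratio - 1"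
  using golden_ratio_pos golden_ratio_square by (simp add: field_simps power2_eq_square)

lemma norm_vec3_square: "(norm (x::real^3))\<^sup>2 = (x$1)\<^sup>2 + (x$2)\<^sup>2 + (x$3)\<^sup>2"
  unfolding power2_norm_eq_inner by (simp add: inner_vec_def sum_3 power2_eq_square)

lemma inner_vec3: "(x::real^3) \<bullet> y = x$1 * y$1 + x$2 * y$2 + x$3 * y$3"
  by (simp add: inner_vec_def sum_3)

lemma eq_vec3: "(x::real^3) = y \<longleftrightarrow> x$1 = y$1 \<and> x$2 = y$2 \<and> x$3 = y$3"
  by (simp add: vec_eq_iff forall_3)

section \<open>Criteria for designs\<close>

text \<open>Coordinates and the squared radius \<open>q\<close> replace norms and roots, so that the
  moments can be checked as polynomial identities.\<close>

lemma spherical_design_2I: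
  fixes V :: "(real^3) set" and q :: real
  assumes "finite V" "V \<noteq> {}" "q > 0"
    and "\<And>v. v \<in> V \<Longrightarrow> (v$1)\<^sup>2 + (v$2)\<^sup>2 + (v$3)\<^sup>2 = q"
    and "\<And>x. (\<Sum>v\<in>V. v \<bullet> x) = 0"
    and "\<And>x. (\<Sum>v\<in>V. (v \<bullet> x)\<^sup>2) = card V * q / 3 * ((x$1)\<^sup>2 + (x$2)\<^sup>2 + (x$3)\<^sup>2)"
  shows "spherical_design 2 (sqrt q) V"
proof -
  have "norm v = sqrt q" if "v \<in> V" for v
    using assms(4)[OF that] by (metis norm_vec3_square real_sqrt_unique norm_ge_zero)
  moreover have "(\<Sum>v\<in>V. (v \<bullet> x) ^ k) =
        (if odd k then 0 else card V * (sqrt q * norm x) ^ k / (real k + 1))" if k: "k \<le> 2" for k x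
  proof -
    consider "k = 0" | "k = 1" | "k = 2" using k by linarith
    thus ?thesis
      by cases (use assms in \<open>simp_all add: power_mult_distrib norm_vec3_square\<close>)
  qed
  ultimately show ?thesis
    using assms by (simp add: spherical_design_def)
qed

lemma sum_odd_power_symmetric:
  fixes V :: "('a::real_inner) set"
  assumes "\<And>v. v \<in> V \<Longrightarrow> - v \<in> V" "odd k"
  shows "(\<Sum>v\<in>V. (v \<bullet> x) ^ k) = 0"
proof -
  have "(\<Sum>v\<in>V. (v \<bullet> x) ^ k) = (\<Sum>v\<in>V. (- v \<bullet> x) ^ k)"
    by (rule sum.reindex_bij_witness[of _ uminus uminus]) (use assms(1) in auto)
  also have "\<dots> = - (\<Sum>v\<in>V. (v \<bullet> x) ^ k)"
    using assms(2) by (simp add: sum_negf)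
  finally show ?thesis by simp
qed

text \<open>Central symmetry makes odd moments vanish, so an even strength rises by one at no
  cost.\<close>

lemma spherical_design_symmetric:
  assumes "spherical_design t r V" "even t" "\<And>v. v \<in> V \<Longrightarrow> - v \<in> V"
  shows "spherical_design (Suc t) r V"
proof -
  have "(\<Sum>v\<in>V. (v \<bullet> x) ^ k) =
        (if odd k then 0 else card V * (r * norm x) ^ k / (real k + 1))" if "k \<le> Suc t" for k x
  proof (cases "k = Suc t")
    case True
    thus ?thesis
      using assms(2) sum_odd_power_symmetric[OF assms(3), of k x] by simp
  next
    case False
    thus ?thesis
      using that by (intro spherical_design_moment[OF assms(1)]) simp
  qed
  thus ?thesis
    using assms(1) by (simp add: spherical_design_def)
qed

text \<open>Symmetry yields the moments of order 3 and 5, which leaves only the fourth to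
  compute.\<close>

lemma spherical_design_5I:
  fixes V :: "(real^3) set" and q :: real
  assumes V: "spherical_design 2 (sqrt q) V" and sym: "\<And>v. v \<in> V \<Longrightarrow> - v \<in> V"
    and 4: "\<And>x. (\<Sum>v\<in>V. (v \<bullet> x) ^ 4) =
      card V * q\<^sup>2 / 5 * ((x$1)\<^sup>2 + (x$2)\<^sup>2 + (x$3)\<^sup>2)\<^sup>2"
  shows "spherical_design 5 (sqrt q) V"
proof -
  have q: "q > 0" using V by (simp add: spherical_design_def)
  have V3: "spherical_design 3 (sqrt q) V"
    using spherical_design_symmetric[OF V _ sym] by simp
  have "(sqrt q * norm x) ^ 4 = q\<^sup>2 * ((x$1)\<^sup>2 + (x$2)\<^sup>2 + (x$3)\<^sup>2)\<^sup>2" for x :: "real^3"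
  proof -
    have "(sqrt q * norm x) ^ 4 = ((sqrt q)\<^sup>2 * (norm x)\<^sup>2)\<^sup>2"
      by (simp add: power_mult_distrib)
    thus ?thesis
      using q by (simp add: norm_vec3_square power_mult_distrib)
  qed
  hence "(\<Sum>v\<in>V. (v \<bullet> x) ^ k) =
        (if odd k then 0 else card V * (sqrt q * norm x) ^ k / (real k + 1))" if "k \<le> 4" for k x
    using that 4 spherical_design_moment[OF V3, of k x] by (cases "k = 4") auto
  hence "spherical_design 4 (sqrt q) V"
    using V by (simp add: spherical_design_def)
  thus ?thesis
    using spherical_design_symmetric[OF _ _ sym, of 4] by simp
qed

section \<open>Explicit sums over the vertex sets\<close>

lemma sum_sign_pairs:
  fixes f :: "real \<Rightarrow> real \<Rightarrow> 'a"
  assumes "\<And>a b a' b'. f a b = f a' b' \<Longrightarrow> a = a' \<and> b = b'"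
  shows "sum g {f a b | a b. a \<in> {1, -1} \<and> b \<in> {1, -1}} =
    g (f 1 1) + (g (f 1 (-1)) + (g (f (-1) 1) + g (f (-1) (-1))))"
proof -
  have "{f a b | a b. a \<in> {1, -1} \<and> b \<in> {1, -1}} = {f 1 1, f 1 (-1), f (-1) 1, f (-1) (-1)}"
    by auto
  moreover have "f 1 1 \<notin> {f 1 (-1), f (-1) 1, f (-1) (-1)}"
    "f 1 (-1) \<notin> {f (-1) 1, f (-1) (-1)}" "f (-1) 1 \<noteq> f (-1) (-1)"
    by (auto dest!: assms)
  ultimately show ?thesis by simp
qed

lemma finite_sign_pairs: "finite {f a b | a b. a \<in> {1, -1::real} \<and> b \<in> {1, -1::real}}"
  by (rule finite_subset[of _ "(\<lambda>(a, b). f a b) ` ({1, -1} \<times> {1, -1})"]) auto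

text \<open>Serves both the cube and eight of the vertices of the dodecahedron.\<close>

definition cube_vertices :: "(real^3) set" where
  "cube_vertices = {vector [a, b, c] | a b c. a \<in> {1, -1} \<and> b \<in> {1, -1} \<and> c \<in> {1, -1}}"

lemma finite_cube_vertices: "finite cube_vertices"
  unfolding cube_vertices_def
  by (rule finite_subset[of _ "(\<lambda>(a, b, c). vector [a, b, c]) ` ({1, -1} \<times> {1, -1} \<times> {1, -1})"]) force+

lemma sum_cube_vertices:
  "sum g cube_vertices =
     g (vector [1, 1, 1]) + (g (vector [1, 1, -1]) + (g (vector [1, -1, 1]) + (g (vector [1, -1, -1]) +
    (g (vector [-1, 1, 1]) + (g (vector [-1, 1, -1]) + (g (vector [-1, -1, 1]) + g (vector [-1, -1, -1])))))))"
proof -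
  have eq: "cube_vertices = {vector [1, 1, 1], vector [1, 1, -1], vector [1, -1, 1], vector [1, -1, -1],
    vector [-1, 1, 1], vector [-1, 1, -1], vector [-1, -1, 1], vector [-1, -1, -1]}"
    unfolding cube_vertices_def by auto
  show ?thesis
    unfolding eq by (simp add: eq_vec3 add.assoc)
qed

text \<open>Three rectangles in the coordinate planes, permuted cyclically. With
  \<open>p = 1\<close> and \<open>q = golden_ratio\<close> they give the icosahedron; with
  \<open>p = golden_ratio\<close> and \<open>q = 1 / golden_ratio\<close>, the twelve vertices that
  the dodecahedron has besides those of the cube.\<close>

definition cyclic_rectangles :: "real \<Rightarrow> real \<Rightarrow> (real^3) set" where
  "cyclic_rectangles p q =
      {vector [0, a * p, b * q] | a b. a \<in> {1, -1} \<and> b \<in> {1, -1}} \<union>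
      {vector [a * p, b * q, 0] | a b. a \<in> {1, -1} \<and> b \<in> {1, -1}} \<union>
      {vector [b * q, 0, a * p] | a b. a \<in> {1, -1} \<and> b \<in> {1, -1}}"

lemma finite_cyclic_rectangles: "finite (cyclic_rectangles p q)"
  unfolding cyclic_rectangles_def by (intro finite_UnI finite_sign_pairs)

lemma sum_cyclic_rectangles:
  assumes "p \<noteq> 0" "q \<noteq> 0"
  shows "sum g (cyclic_rectangles p q) =
    (g (vector [0, p, q]) + (g (vector [0, p, -q]) + (g (vector [0, -p, q]) + g (vector [0, -p, -q])))) +
    (g (vector [p, q, 0]) + (g (vector [p, -q, 0]) + (g (vector [-p, q, 0]) + g (vector [-p, -q, 0])))) +
    (g (vector [q, 0, p]) + (g (vector [q, 0, -p]) + (g (vector [-q, 0, p]) + g (vector [-q, 0, -p]))))"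
proof -
  let ?A = "{vector [0, a * p, b * q] | a b. a \<in> {1, -1} \<and> b \<in> {1, -1}} :: (real^3) set"
  let ?B = "{vector [a * p, b * q, 0] | a b. a \<in> {1, -1} \<and> b \<in> {1, -1}} :: (real^3) set"
  let ?C = "{vector [b * q, 0, a * p] | a b. a \<in> {1, -1} \<and> b \<in> {1, -1}} :: (real^3) set"
  \<comment> \<open>The position of the zero coordinate tells the three rectangles apart.\<close>
  have A: "v$1 = 0" "v$2 \<noteq> 0" "v$3 \<noteq> 0" if "v \<in> ?A" for v
    using that assms by auto
  have B: "v$1 \<noteq> 0" "v$2 \<noteq> 0" "v$3 = 0" if "v \<in> ?B" for v
    using that assms by auto
  have C: "v$1 \<noteq> 0" "v$2 = 0" "v$3 \<noteq> 0" if "v \<in> ?C" for v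
    using that assms by auto
  have "?A \<inter> ?B = {}"
    using A(1) B(1) by (meson disjoint_iff)
  moreover have "(?A \<union> ?B) \<inter> ?C = {}"
    using A(2) B(2) C(2) by (meson UnE disjoint_iff)
  ultimately have "sum g (cyclic_rectangles p q) = sum g ?A + sum g ?B + sum g ?C"
    unfolding cyclic_rectangles_def by (simp only: sum.union_disjoint finite_sign_pairs finite_UnI)
  also have "sum g ?A =
      g (vector [0, p, q]) + (g (vector [0, p, -q]) + (g (vector [0, -p, q]) + g (vector [0, -p, -q])))"
    by (subst sum_sign_pairs) (use assms in \<open>auto simp: eq_vec3\<close>)
  also have "sum g ?B =
      g (vector [p, q, 0]) + (g (vector [p, -q, 0]) + (g (vector [-p, q, 0]) + g (vector [-p, -q, 0])))"
    by (subst sum_sign_pairs) (use assms in \<open>auto simp: eq_vec3\<close>)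
  \<comment> \<open>The terms are reordered so that the sign of the first coordinate varies slowest,
    as in \<open>pow4_sign_pairs\<close>.\<close>
  also have "sum g ?C =
      g (vector [q, 0, p]) + (g (vector [q, 0, -p]) + (g (vector [-q, 0, p]) + g (vector [-q, 0, -p])))"
    by (subst sum_sign_pairs) (use assms in \<open>auto simp: eq_vec3 add_ac\<close>)
  finally show ?thesis .
qed

section \<open>Moments and strengths of the five solids\<close>

text \<open>The strength stops at 2: the third moment is
  \<open>24 * x$1 * x$2 * x$3\<close>.\<close>

lemma tetrahedron_design:
  "spherical_design 2 (sqrt 3)
     {vector [1, 1, 1], vector [1, -1, -1], vector [-1, 1, -1], vector [-1, -1, 1] :: real^3}"
  by (rule spherical_design_2I) (auto simp: inner_vec3 eq_vec3 power2_eq_square algebra_simps)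

lemma octahedron_design:
  "spherical_design 3 (sqrt 1)
     {vector [1, 0, 0], vector [-1, 0, 0], vector [0, 1, 0],
      vector [0, -1, 0], vector [0, 0, 1], vector [0, 0, -1] :: real^3}"
    (is "spherical_design _ _ ?V")
proof -
  have "spherical_design 2 (sqrt 1) ?V"
    by (rule spherical_design_2I) (auto simp: inner_vec3 eq_vec3 power2_eq_square algebra_simps)
  moreover have "- v \<in> ?V" if "v \<in> ?V" for v
    using that by (auto simp: eq_vec3)
  ultimately show ?thesis
    using spherical_design_symmetric[of 2 "sqrt 1" ?V] by (simp only: eval_nat_numeral) simp
qed

text \<open>Summing over signs kills odd exponents. The nesting and the \<open>+ -\<close> match the
  unfolded vertex sums, so that this works as a rewrite rule.\<close>

lemma pow4_sign_pairs:
  fixes y z :: real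
  shows "(y + z) ^ 4 + ((y + - z) ^ 4 + ((- y + z) ^ 4 + (- y + - z) ^ 4)) =
    4 * y ^ 4 + 24 * y\<^sup>2 * z\<^sup>2 + 4 * z ^ 4"
  by algebra

lemma pow4_sign_triples:
  fixes x y z :: real
  shows "(x + y + z) ^ 4 + ((x + y + - z) ^ 4 + ((x + - y + z) ^ 4 + ((x + - y + - z) ^ 4 +
    ((- x + y + z) ^ 4 + ((- x + y + - z) ^ 4 + ((- x + - y + z) ^ 4 + (- x + - y + - z) ^ 4)))))) =
    8 * (x ^ 4 + y ^ 4 + z ^ 4) + 48 * (x\<^sup>2 * y\<^sup>2 + y\<^sup>2 * z\<^sup>2 + z\<^sup>2 * x\<^sup>2)"
    (is "?l = ?r")
proof -
  \<comment> \<open>The eight terms split into two sign pairs, one for \<open>x + y\<close> and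
    \<open>z\<close>, one for \<open>x + - y\<close> and \<open>z\<close>.\<close>
  have "?l = ((x + y + z) ^ 4 + ((x + y + - z) ^ 4 + ((- (x + y) + z) ^ 4 + (- (x + y) + - z) ^ 4))) +
    ((x + - y + z) ^ 4 + ((x + - y + - z) ^ 4 + ((- (x + - y) + z) ^ 4 + (- (x + - y) + - z) ^ 4)))"
    by (simp add: add_ac)
  also have "\<dots> = ?r"
    unfolding pow4_sign_pairs by algebra
  finally show ?thesis .
qed

text \<open>The fourth moment, where 48 is not twice 8, is no multiple of \<open>norm x ^ 4\<close>;
  it is for the dodecahedron, whose other twelve vertices make up for this.\<close>

lemma cube_moments:
  "card cube_vertices = 8"
  "(\<Sum>v\<in>cube_vertices. (v \<bullet> x)\<^sup>2) = 8 * ((x$1)\<^sup>2 + (x$2)\<^sup>2 + (x$3)\<^sup>2)"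
  "(\<Sum>v\<in>cube_vertices. (v \<bullet> x) ^ 4) = 8 * ((x$1) ^ 4 + (x$2) ^ 4 + (x$3) ^ 4) +
     48 * ((x$1)\<^sup>2 * (x$2)\<^sup>2 + (x$2)\<^sup>2 * (x$3)\<^sup>2 + (x$3)\<^sup>2 * (x$1)\<^sup>2)"
  unfolding card_eq_sum sum_cube_vertices inner_vec3 vector_3 mult_minus_left mult_1_left pow4_sign_triples
  by (simp_all add: algebra_simps power2_eq_square)

text \<open>The fourth moment is a multiple of \<open>norm x ^ 4\<close> exactly when the mixed
  coefficient is twice the pure one, that is, when
  \<open>p ^ 4 + q ^ 4 = 3 * p\<^sup>2 * q\<^sup>2\<close>.\<close>

lemma cyclic_rectangles_moments:
  assumes "p \<noteq> 0" "q \<noteq> 0"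
  shows "card (cyclic_rectangles p q) = 12"
    "(\<Sum>v\<in>cyclic_rectangles p q. (v \<bullet> x)\<^sup>2) =
       4 * (p\<^sup>2 + q\<^sup>2) * ((x$1)\<^sup>2 + (x$2)\<^sup>2 + (x$3)\<^sup>2)"
    "(\<Sum>v\<in>cyclic_rectangles p q. (v \<bullet> x) ^ 4) =
       4 * (p ^ 4 + q ^ 4) * ((x$1) ^ 4 + (x$2) ^ 4 + (x$3) ^ 4) +
       24 * p\<^sup>2 * q\<^sup>2 * ((x$1)\<^sup>2 * (x$2)\<^sup>2 + (x$2)\<^sup>2 * (x$3)\<^sup>2 + (x$3)\<^sup>2 * (x$1)\<^sup>2)"
  unfolding card_eq_sum sum_cyclic_rectangles[OF assms] inner_vec3 vector_3 mult_minus_left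
    mult_zero_left add_0 add_0_right pow4_sign_pairs
  by (simp_all add: algebra_simps power2_eq_square)

lemma uminus_cube_vertices: "v \<in> cube_vertices \<Longrightarrow> - v \<in> cube_vertices"
proof -
  assume "v \<in> cube_vertices"
  then obtain a b c where "v = vector [a, b, c]" and abc: "a \<in> {1, -1}" "b \<in> {1, -1}" "c \<in> {1, -1}"
    unfolding cube_vertices_def by blast
  hence "- v = vector [- a, - b, - c]" by (simp add: eq_vec3)
  moreover have "- a \<in> {1, -1}" "- b \<in> {1, -1}" "- c \<in> {1, -1}"
    using abc by auto
  ultimately show ?thesis
    unfolding cube_vertices_def by blast
qed

lemma uminus_sign_pairs:
  fixes f :: "real \<Rightarrow> real \<Rightarrow> 'a::uminus"
  assumes "v \<in> {f a b | a b. a \<in> {1, -1} \<and> b \<in> {1, -1}}" "\<And>a b. - f a b = f (- a) (- b)"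
  shows "- v \<in> {f a b | a b. a \<in> {1, -1} \<and> b \<in> {1, -1}}"
proof -
  obtain a b where "v = f a b" and ab: "a \<in> {1, -1}" "b \<in> {1, -1}"
    using assms(1) by blast
  hence "- v = f (- a) (- b)" by (simp add: assms(2))
  moreover have "- a \<in> {1, -1}" "- b \<in> {1, -1}"
    using ab by auto
  ultimately show ?thesis by blast
qed

lemma uminus_cyclic_rectangles: "v \<in> cyclic_rectangles p q \<Longrightarrow> - v \<in> cyclic_rectangles p q"
  unfolding cyclic_rectangles_def
  by (elim UnE; drule uminus_sign_pairs; simp add: eq_vec3)

lemma cube_design: "spherical_design 3 (sqrt 3) cube_vertices"
proof -
  have "spherical_design 2 (sqrt 3) cube_vertices"
  proof (intro spherical_design_2I finite_cube_vertices)
    show "(\<Sum>v\<in>cube_vertices. v \<bullet> x) = 0" for x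
      using sum_odd_power_symmetric[OF uminus_cube_vertices, of 1 x] by simp
    show "cube_vertices \<noteq> {}"
      using cube_moments(1) by auto
  qed (auto simp: cube_moments, auto simp: cube_vertices_def)
  thus ?thesis
    using spherical_design_symmetric[OF _ _ uminus_cube_vertices, of 2] by simp
qed

lemma cyclic_rectangles_norm:
  "v \<in> cyclic_rectangles p q \<Longrightarrow> (v$1)\<^sup>2 + (v$2)\<^sup>2 + (v$3)\<^sup>2 = p\<^sup>2 + q\<^sup>2"
  unfolding cyclic_rectangles_def by auto

lemma icosahedron_design:
  "spherical_design 5 (sqrt (golden_ratio + 2)) (cyclic_rectangles 1 golden_ratio)"
proof (intro spherical_design_5I spherical_design_2I finite_cyclic_rectangles)
  have nz: "(1::real) \<noteq> 0" "golden_ratio \<noteq> 0" using golden_ratio_pos by auto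
  note m = cyclic_rectangles_moments[OF nz]
  show "cyclic_rectangles 1 golden_ratio \<noteq> {}" "golden_ratio + 2 > 0"
    using m(1) golden_ratio_pos by auto
  show "(v$1)\<^sup>2 + (v$2)\<^sup>2 + (v$3)\<^sup>2 = golden_ratio + 2" if "v \<in> cyclic_rectangles 1 golden_ratio" for v
    using cyclic_rectangles_norm[OF that] golden_ratio_square by simp
  fix x :: "real^3"
  show "(\<Sum>v\<in>cyclic_rectangles 1 golden_ratio. v \<bullet> x) = 0"
    using sum_odd_power_symmetric[of "cyclic_rectangles 1 golden_ratio" 1]
      uminus_cyclic_rectangles by simp
  show "(\<Sum>v\<in>cyclic_rectangles 1 golden_ratio. (v \<bullet> x)\<^sup>2) =
    real (card (cyclic_rectangles 1 golden_ratio)) * (golden_ratio + 2) / 3 *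
      ((x$1)\<^sup>2 + (x$2)\<^sup>2 + (x$3)\<^sup>2)"
    unfolding m(1,2) golden_ratio_square by (simp add: field_simps)
  \<comment> \<open>The first identity makes the mixed coefficient twice the pure one; the second
    matches the result, \<open>12 * golden_ratio\<^sup>2\<close>, with the radius.\<close>
  have 4: "golden_ratio ^ 4 = 3 * golden_ratio\<^sup>2 - 1"
    and 2: "(golden_ratio + 2)\<^sup>2 = 5 * golden_ratio\<^sup>2"
    using golden_ratio_square by algebra+
  show "(\<Sum>v\<in>cyclic_rectangles 1 golden_ratio. (v \<bullet> x) ^ 4) =
    real (card (cyclic_rectangles 1 golden_ratio)) * (golden_ratio + 2)\<^sup>2 / 5 *
      ((x$1)\<^sup>2 + (x$2)\<^sup>2 + (x$3)\<^sup>2)\<^sup>2"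
    unfolding m(1,3) 4 2 by simp algebra
qed (rule uminus_cyclic_rectangles)

text \<open>Points of the rectangles have a zero coordinate, vertices of the cube have none.\<close>

lemma sum_cube_cyclic_rectangles:
  assumes "p \<noteq> 0" "q \<noteq> 0"
  shows "sum g (cube_vertices \<union> cyclic_rectangles p q) = sum g cube_vertices + sum g (cyclic_rectangles p q)"
  by (rule sum.union_disjoint[OF finite_cube_vertices finite_cyclic_rectangles])
    (use assms in \<open>auto simp: cube_vertices_def cyclic_rectangles_def eq_vec3\<close>)

lemma dodecahedron_design:
  "spherical_design 5 (sqrt 3) (cube_vertices \<union> cyclic_rectangles golden_ratio (1 / golden_ratio))"
    (is "spherical_design _ _ ?V")
proof (intro spherical_design_5I spherical_design_2I
    finite_UnI finite_cube_vertices finite_cyclic_rectangles)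
  have nz: "golden_ratio \<noteq> 0" "1 / golden_ratio \<noteq> 0" using golden_ratio_pos by auto
  note m = cyclic_rectangles_moments[OF nz] cube_moments sum_cube_cyclic_rectangles[OF nz]
  have card: "card ?V = 20"
    using m(1,4) by (simp only: card_eq_sum m(7))
  thus "?V \<noteq> {}" by auto
  have pq: "golden_ratio\<^sup>2 * (1 / golden_ratio)\<^sup>2 = 1"
    using nz by (simp add: power2_eq_square)
  have 2: "golden_ratio\<^sup>2 + (1 / golden_ratio)\<^sup>2 = 3"
    unfolding inverse_golden_ratio using golden_ratio_square by algebra
  \<comment> \<open>Two numbers with sum 3 and product 1 have squares with sum 9 - 2.\<close>
  have 4: "golden_ratio ^ 4 + (1 / golden_ratio) ^ 4 = 7"
    using pq 2 by algebra
  show "(v$1)\<^sup>2 + (v$2)\<^sup>2 + (v$3)\<^sup>2 = 3" if "v \<in> ?V" for v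
    using that cyclic_rectangles_norm[of v] 2 by (auto simp: cube_vertices_def)
  fix x :: "real^3"
  have sym: "- v \<in> ?V" if "v \<in> ?V" for v
    using that uminus_cube_vertices uminus_cyclic_rectangles by blast
  thus "v \<in> ?V \<Longrightarrow> - v \<in> ?V" for v .
  show "(\<Sum>v\<in>?V. v \<bullet> x) = 0"
    using sum_odd_power_symmetric[of ?V 1, OF sym] by simp
  show "(\<Sum>v\<in>?V. (v \<bullet> x)\<^sup>2) = real (card ?V) * 3 / 3 * ((x$1)\<^sup>2 + (x$2)\<^sup>2 + (x$3)\<^sup>2)"
    unfolding card m 2 by simp
  have 24: "24 * golden_ratio\<^sup>2 * (1 / golden_ratio)\<^sup>2 = 24"
    using pq by simp
  \<comment> \<open>The pure coefficient is 8 + 4 * 7 = 36 = 20 * 9 / 5, and the mixed one is 48 +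
    24 = 72, twice as much.\<close>
  show "(\<Sum>v\<in>?V. (v \<bullet> x) ^ 4) = real (card ?V) * 3\<^sup>2 / 5 * ((x$1)\<^sup>2 + (x$2)\<^sup>2 + (x$3)\<^sup>2)\<^sup>2"
    unfolding card m 4 24 by simp algebra
qed simp

section \<open>The averages of the Platonic solids\<close>

text \<open>The number of vertices matters to the averages only through the strength
  \<open>t\<close>, so lower bounds for \<open>t\<close> are all that is kept.\<close>

lemma platonic_solid_design:
  assumes "platonic_solid n P"
  obtains V r t where "similar P (convex hull V)" "spherical_design t r V" "2 \<le> t"
    "n \<in> {6, 8, 12, 20} \<longrightarrow> 3 \<le> t" "n \<in> {12, 20} \<longrightarrow> 5 \<le> t"
proof -
  have ico: "std_icosahedron = convex hull (cyclic_rectangles 1 golden_ratio)"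
    by (simp add: std_icosahedron_def cyclic_rectangles_def)
  have dod: "std_dodecahedron =
      convex hull (cube_vertices \<union> cyclic_rectangles golden_ratio (1 / golden_ratio))"
    by (simp add: std_dodecahedron_def cube_vertices_def cyclic_rectangles_def Un_assoc)
  have cub: "std_cube = convex hull cube_vertices"
    by (simp add: std_cube_def cube_vertices_def)
  from assms consider
    "n = 4" "similar P std_tetrahedron" | "n = 6" "similar P std_octahedron" |
    "n = 8" "similar P std_cube" | "n = 12" "similar P std_icosahedron" |
    "n = 20" "similar P std_dodecahedron"
    unfolding platonic_solid_def regular_tetrahedron_def regular_octahedron_def cube_def
      regular_icosahedron_def regular_dodecahedron_def by blast
  thus thesis
  proof cases
    case 1 thus ?thesis
      by (intro that[OF _ tetrahedron_design]) (auto simp: std_tetrahedron_def)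
  next
    case 2 thus ?thesis
      by (intro that[OF _ octahedron_design]) (auto simp: std_octahedron_def)
  next
    case 3 thus ?thesis
      by (intro that[OF _ cube_design]) (auto simp: cub)
  next
    case 4 thus ?thesis
      by (intro that[OF _ icosahedron_design]) (auto simp: ico)
  next
    case 5 thus ?thesis
      by (intro that[OF _ dodecahedron_design]) (auto simp: dod)
  qed
qed

theorem theorem7p1:
  fixes P :: "(real^3) set" and M :: "real^3" and R L :: real and n :: nat
  assumes "platonic_solid n P"
    and "R > 0"
    and "has_circumradius P R"
    and "dist M (centroid P) = L"
  shows "(n \<in> {4, 6, 8, 12, 20} \<longrightarrow>
            cyclic_average P M 2 = R^2 + L^2) \<and>
         (n \<in> {4, 6, 8, 12, 20} \<longrightarrow>
            cyclic_average P M 4 = (R^2 + L^2)^2 + 4 / 3 * R^2 * L^2) \<and>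
         (n \<in> {6, 8, 12, 20} \<longrightarrow>
            cyclic_average P M 6 = (R^2 + L^2)^3 + 4 * R^2 * L^2 * (R^2 + L^2)) \<and>
         (n \<in> {12, 20} \<longrightarrow>
            cyclic_average P M 8 =
              (R^2 + L^2)^4 + 8 * R^2 * L^2 * (R^2 + L^2)^2 + 16 / 5 * R^4 * L^4) \<and>
         (n \<in> {12, 20} \<longrightarrow>
            cyclic_average P M 10 =
              (R^2 + L^2)^5 + 40 / 3 * R^2 * L^2 * (R^2 + L^2)^3
                + 16 * R^4 * L^4 * (R^2 + L^2))"
proof -
  obtain V r t where V: "similar P (convex hull V)" "spherical_design t r V" "2 \<le> t"
    and t: "n \<in> {6, 8, 12, 20} \<longrightarrow> 3 \<le> t" "n \<in> {12, 20} \<longrightarrow> 5 \<le> t"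
    using platonic_solid_design[OF assms(1)] by metis
  note avg = cyclic_average_similar_design[OF V assms(3,2,4)]
  \<comment> \<open>The term \<open>k = 2\<close> contributes \<open>(m choose 2) * 4 / 3\<close>
    times \<open>R^2 * L^2\<close>, and \<open>k = 4\<close> contributes
    \<open>(m choose 4) * 16 / 5\<close> times \<open>R^4 * L^4\<close>, each with its power of
    \<open>R^2 + L^2\<close>.\<close>
  have binom: "3 choose 2 = (3::nat)" "4 choose 2 = (6::nat)" "5 choose 2 = (10::nat)" "5 choose 4 = (5::nat)"
    by (simp_all add: eval_nat_numeral)
  have 1: "cyclic_average P M 2 = R^2 + L^2"
    using avg[of 1] V(3) by simp
  have 2: "cyclic_average P M 4 = (R^2 + L^2)^2 + 4 / 3 * R^2 * L^2"
    using avg[of 2] V(3) by (simp add: atMost_nat_numeral binom field_simps)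
  have 3: "cyclic_average P M 6 = (R^2 + L^2)^3 + 4 * R^2 * L^2 * (R^2 + L^2)" if "3 \<le> t"
    using avg[OF that] by (simp add: atMost_nat_numeral binom field_simps)
  have 4: "cyclic_average P M 8 =
      (R^2 + L^2)^4 + 8 * R^2 * L^2 * (R^2 + L^2)^2 + 16 / 5 * R^4 * L^4" if "5 \<le> t"
    using avg[of 4] that by (simp add: atMost_nat_numeral binom field_simps)
  have 5: "cyclic_average P M 10 =
      (R^2 + L^2)^5 + 40 / 3 * R^2 * L^2 * (R^2 + L^2)^3 + 16 * R^4 * L^4 * (R^2 + L^2)" if "5 \<le> t"
    using avg[OF that] by (simp add: atMost_nat_numeral binom field_simps)
  show ?thesis
    using 1 2 3 4 5 t by blast
qed

end
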